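(* Keep $m$ and the sets $S_j$ ($j\in[m]$) fixed, and with the notation of the context define the following sets of laws: $$\mathcal{D}_1=\{\mathcal{L}_{\boldsymbol\chi}:\alpha_{j,\boldsymbol\chi}>0\text{ for each }j\in[m]\},\qquad \mathcal{D}_2=\{\mathcal{L}_{\boldsymbol\chi}:\beta_{j,\boldsymbol\chi}>0\text{ for each }j\in[m]\},$$ $$\mathcal{D}_3=\Big\{\mathcal{L}_{\boldsymbol\chi}:\mathbf{E}_{\mathcal{L}_{\boldsymbol\chi}}\Big[\sum_{k\in S_j}X_{v,k}\Big|\sigma(v)=j\Big]<\infty\text{ for each }j\in[m]\Big\},$$ $$\mathcal{D}_4=\Big\{\mathcal{L}_{\boldsymbol\chi}:\mathbf{E}_{\mathcal{L}_{\boldsymbol\chi}}\Big[\sum_{k\in[m]\setminus S_j}X_{v,k}\Big|\sigma(v)=j\Big]<\infty\text{ for each }j\in[m]\Big\},$$ $$\mathcal{C}_1=\{\mathcal{L}_{\boldsymbol\chi}:G_{j,S_j,\boldsymbol\chi}(\beta_{k,\boldsymbol\chi}:k\in S_j)>\alpha_{j,\boldsymbol\chi}\text{ for each }j\in[m]\},$$ $$\mathcal{C}_2=\{\mathcal{L}_{\boldsymbol\chi}:G_{j,[m]\setminus S_j,\boldsymbol\chi}(\alpha_{k,\boldsymbol\chi}:k\in[m]\setminus S_j)>\beta_{j,\boldsymbol\chi}\text{ for each }j\in[m]\}.$$ Then for each $i=1,2$ and $j\in[m]$: (i) If $\mathcal{L}_{\boldsymbol\chi}\in(\mathcal{D}_1\cup\mathcal{D}_4)\cap(\mathcal{D}_2\cup\mathcal{D}_3)$,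 then $\mathrm{nw}_{i,j,\cdot}$ and $\mathrm{nl}_{i,j,\cdot}$, as functions of the law, are lower semicontinuous at $\mathcal{L}_{\boldsymbol\chi}$ with respect to the metric $d_0$. If, moreover, $\mathrm{nd}_{i,j,\boldsymbol\chi}=0$, then they are continuous at $\mathcal{L}_{\boldsymbol\chi}$. (ii) If $\mathcal{L}_{\boldsymbol\chi}\in(\mathcal{C}_1\cup\mathcal{D}_4)\cap(\mathcal{C}_2\cup\mathcal{D}_3)$, then $\mathrm{mw}_{i,j,\cdot}$ and $\mathrm{ml}_{i,j,\cdot}$, as functions of the law, are lower semicontinuous at $\mathcal{L}_{\boldsymbol\chi}$ with respect to $d_0$. If, moreover, $\mathrm{md}_{i,j,\boldsymbol\chi}=0$, then they are continuous at $\mathcal{L}_{\boldsymbol\chi}$. (iii) If $\mathcal{L}_{\boldsymbol\chi}\in\mathcal{D}_3\cap\mathcal{D}_4$, then $\mathrm{esw}_{j,\cdot}$ and $\mathrm{eel}_{j,\cdot}$, as functions of the law, are lower semicontinuous at $\mathcal{L}_{\boldsymbol\chi}$ with respect to $d_0$.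
   Context: Tree. $[m]=\{1,\ldots,m\}$ is a finite set of colours, $\mathbf{p}=(p_1,\ldots,p_m)$ a probability vector, and $\boldsymbol\chi=(\chi_j:j\in[m])$ with $\chi_1,\ldots,\chi_m$ probability distributions on $\mathbb{N}_0^m$. The rooted multi-type Galton-Watson tree $\mathcal{T}_{\boldsymbol\chi}$ is generated as follows: the root $\phi$ gets a colour $\sigma(\phi)\in[m]$ according to $\mathbf{p}$; then every vertex $v$ with colour $\sigma(v)=i$ gives birth, independently of all else, to $X_{v,j}$ children of colour $j$ for all $j\in[m]$, where $(X_{v,1},\ldots,X_{v,m})\sim\chi_i$. Edges $(u,v)$ are directed from parent $u$ to child $v$. The law of $\mathcal{T}_{\boldsymbol\chi}$ is denoted $\mathcal{L}_{\boldsymbol\chi}$, with expectation $\mathbf{E}_{\mathcal{L}_{\boldsymbol\chi}}$. The distance between two laws is $d_0(\mathcal{L}_{\boldsymbol\chi},\mathcal{L}_{\boldsymbol\eta})=\max\{\|\chi_j-\eta_j\|_{\mathrm{TV}}:j\in[m]\}$, where $\|\cdot\|_{\mathrm{TV}}$ is total variation distance. Games. For each $j\in[m]$ a non-empty proper subset $S_j$ of $[m]$ is fixed. A directed edge $(u,v)$ is permissible for P1 (in the normal and misère games) and for Stopper (in the escape game) if $\sigma(v)\in S_{\sigma(u)}$; it is permissible for P2 and for Escaper if $\sigma(v)\in[m]\setminus S_{\sigma(u)}$. A token is placed on an initial vertex, and the two players alternately move it along a directed edge permissible for the player whose turn it is. Normal game (P1 vs P2): the first player who is unable to move loses. Misère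 game (P1 vs P2): the first player who is unable to move wins. In both, if no player is ever unable to move, the game is a draw. Escape game (Stopper vs Escaper): if either player is ever unable to move, Stopper wins; otherwise Escaper wins. Outcomes are those under optimal play. Quantities (the subscript $\boldsymbol\chi$ indicates they are computed for $\mathcal{T}_{\boldsymbol\chi}$). For $i=1,2$ and $j\in[m]$, conditioned on $\sigma(\phi)=j$: $\mathrm{nw}_{i,j,\boldsymbol\chi}$, $\mathrm{nl}_{i,j,\boldsymbol\chi}$, $\mathrm{nd}_{i,j,\boldsymbol\chi}$ are the probabilities that the normal game with initial vertex $\phi$ and with P$i$ playing the first round is won by P$i$, lost by P$i$, drawn, respectively; $\mathrm{mw}_{i,j,\boldsymbol\chi}$, $\mathrm{ml}_{i,j,\boldsymbol\chi}$, $\mathrm{md}_{i,j,\boldsymbol\chi}$ are the analogous probabilities for the misère game; $\mathrm{esw}_{j,\boldsymbol\chi}$ is the probability that Stopper wins the escape game with initial vertex $\phi$ when Stopper plays the first round; $\mathrm{eel}_{j,\boldsymbol\chi}$ is the probability that Escaper loses the escape game with initial vertex $\phi$ when Escaper plays the first round. For $S\subseteq[m]$, $G_{j,S,\boldsymbol\chi}$ is the probability generating function on $[0,1]^S$ of the law of $(X_{v,k}:k\in S)$ given $\sigma(v)=j$. $\alpha_{j,\boldsymbol\chi}$ (resp. $\beta_{j,\boldsymbol\chi}$) is the probability, conditioned on $\sigma(\phi)=j$, that $\phi$ has no child of colour $k$ for any $k\in S_j$ (resp. any $k\in[m]\setminus S_j$). *)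

theory Defs
  imports "HOL-Probability.Probability"
begin

section \<open>Offspring distributions and the metric \<open>d\<^sub>0\<close>\<close>

text \<open>
  The set of colours \<open>[m]\<close> is the universe of an arbitrary finite type \<open>'c\<close>, so an element of
  \<open>\<nat>\<^sub>0\<^sup>m\<close> is a function \<open>'c \<Rightarrow> nat\<close>. The tuple \<open>\<chi> = (\<chi>\<^sub>j)\<^sub>j\<close> of offspring
  distributions is written \<open>\<mu>\<close> below, because the symbol \<open>\<chi>\<close> is a binder in HOL-Analysis. A law
  \<open>\<L>\<^sub>\<chi>\<close> is represented by its parameter \<open>\<chi>\<close>; this is what \<open>d\<^sub>0\<close> depends on.
\<close>

type_synonym 'c offspring = "'c \<Rightarrow> ('c \<Rightarrow> nat) pmf"

definition tv_dist :: "'a pmf \<Rightarrow> 'a pmf \<Rightarrow> real" where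
  "tv_dist p q = (SUP A. \<bar>measure_pmf.prob p A - measure_pmf.prob q A\<bar>)"

definition d0 :: "'c::finite offspring \<Rightarrow> 'c offspring \<Rightarrow> real" where
  "d0 \<mu> \<nu> = Max (range (\<lambda>j. tv_dist (\<mu> j) (\<nu> j)))"

lemma tv_dist_bdd:
  "bdd_above (range (\<lambda>A. \<bar>measure_pmf.prob p A - measure_pmf.prob q A\<bar>))"
proof (rule bdd_aboveI2)
  fix A
  have "0 \<le> measure_pmf.prob p A" "measure_pmf.prob p A \<le> 1"
       "0 \<le> measure_pmf.prob q A" "measure_pmf.prob q A \<le> 1" by auto
  then show "\<bar>measure_pmf.prob p A - measure_pmf.prob q A\<bar> \<le> 1" by linarith
qed

lemma tv_dist_upper: "\<bar>measure_pmf.prob p A - measure_pmf.prob q A\<bar> \<le> tv_dist p q"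
  unfolding tv_dist_def by (rule cSUP_upper[OF _ tv_dist_bdd]) simp

lemma tv_dist_le:
  assumes "\<And>A. \<bar>measure_pmf.prob p A - measure_pmf.prob q A\<bar> \<le> r"
  shows "tv_dist p q \<le> r"
  unfolding tv_dist_def by (rule cSUP_least) (use assms in auto)

lemma tv_dist_nonneg: "0 \<le> tv_dist p q"
  using tv_dist_upper[of p "{}" q] by simp

lemma tv_dist_commute: "tv_dist p q = tv_dist q p"
  unfolding tv_dist_def by (simp add: abs_minus_commute)

lemma tv_dist_triangle: "tv_dist p r \<le> tv_dist p q + tv_dist q r"
proof (rule tv_dist_le)
  fix A
  show "\<bar>measure_pmf.prob p A - measure_pmf.prob r A\<bar> \<le> tv_dist p q + tv_dist q r"
    using tv_dist_upper[of p A q] tv_dist_upper[of q A r] by linarith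
qed

lemma tv_dist_eq_0_iff: "tv_dist p q = 0 \<longleftrightarrow> p = q"
proof
  assume *: "tv_dist p q = 0"
  show "p = q"
  proof (rule pmf_eqI)
    fix x
    have "\<bar>measure_pmf.prob p {x} - measure_pmf.prob q {x}\<bar> \<le> 0"
      using tv_dist_upper[of p "{x}" q] * by simp
    then show "pmf p x = pmf q x" by (simp add: pmf.rep_eq)
  qed
next
  assume "p = q"
  then have "tv_dist p q \<le> 0" by (intro tv_dist_le) simp
  then show "tv_dist p q = 0" using tv_dist_nonneg[of p q] by simp
qed

lemma tv_dist_le_d0: "tv_dist (\<mu> j) (\<nu> j) \<le> d0 \<mu> \<nu>"
  unfolding d0_def by (rule Max_ge) auto

lemma d0_le: "(\<And>j. tv_dist (\<mu> j) (\<nu> j) \<le> r) \<Longrightarrow> d0 \<mu> \<nu> \<le> r"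
  unfolding d0_def by (subst Max_le_iff) auto

interpretation d0: Metric_space UNIV "d0 :: 'c::finite offspring \<Rightarrow> _"
proof
  fix x y z :: "'c offspring"
  show "0 \<le> d0 x y"
    using tv_dist_le_d0[of x undefined y] tv_dist_nonneg[of "x undefined" "y undefined"] by linarith
  show "d0 x y = d0 y x"
    unfolding d0_def by (simp add: tv_dist_commute)
  show "d0 x y = 0 \<longleftrightarrow> x = y"
  proof
    assume *: "d0 x y = 0"
    show "x = y"
    proof
      fix j
      have "tv_dist (x j) (y j) = 0"
        using tv_dist_le_d0[of x j y] tv_dist_nonneg[of "x j" "y j"] * by linarith
      then show "x j = y j" by (simp add: tv_dist_eq_0_iff)
    qed
  next
    assume "x = y"
    then show "d0 x y = 0" by (simp add: d0_def tv_dist_eq_0_iff[THEN iffD2])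
  qed
  show "d0 x z \<le> d0 x y + d0 y z"
  proof (rule d0_le)
    fix j
    show "tv_dist (x j) (z j) \<le> d0 x y + d0 y z"
      using tv_dist_triangle[of "x j" "z j" "y j"] tv_dist_le_d0[of x j y] tv_dist_le_d0[of y j z]
      by linarith
  qed
qed

abbreviation law_topology :: "'c::finite offspring topology" where
  "law_topology \<equiv> d0.mtopology"

text \<open>Lower semicontinuity at a point; continuity at a point is \<^const>\<open>topcontinuous_at\<close>.\<close>

definition lsc_at :: "'a topology \<Rightarrow> ('a \<Rightarrow> real) \<Rightarrow> 'a \<Rightarrow> bool" where
  "lsc_at X f x \<longleftrightarrow>
     x \<in> topspace X \<and>
     (\<forall>y < f x. \<exists>U. openin X U \<and> x \<in> U \<and> (\<forall>z\<in>U. y < f z))"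


section \<open>Multi-type Galton-Watson trees\<close>

text \<open>
  Ulam-Harris labelling: \<open>[]\<close> is the root and \<open>u @ [(k, n)]\<close> is the \<open>n\<close>-th child of colour \<open>k\<close> of
  \<open>u\<close>, counted from 0. A tree is given by its root colour \<open>j\<close> and a field \<open>\<omega>\<close>, where \<open>\<omega> u k\<close> is the
  number \<open>X\<^bsub>u,k\<^esub>\<close> of children of colour \<open>k\<close> of \<open>u\<close>. The field is defined on all labels;
  the vertices of the tree are the labels reachable from \<open>[]\<close> through \<open>children\<close>, and the values of
  \<open>\<omega>\<close> elsewhere are irrelevant.
\<close>

type_synonym 'c vertex = "('c \<times> nat) list"
type_synonym 'c gw_field = "'c vertex \<Rightarrow> 'c \<Rightarrow> nat"

definition colour :: "'c \<Rightarrow> 'c vertex \<Rightarrow> 'c" where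
  "colour j v = (if v = [] then j else fst (last v))"

definition children :: "'c gw_field \<Rightarrow> 'c vertex \<Rightarrow> 'c vertex set" where
  "children \<omega> u = {u @ [(k, n)] | k n. n < \<omega> u k}"

text \<open>The law of the tree conditioned on the root having colour \<open>j\<close>.\<close>

definition gw_from :: "'c offspring \<Rightarrow> 'c \<Rightarrow> 'c gw_field measure" where
  "gw_from \<mu> j = (\<Pi>\<^sub>M v\<in>UNIV. measure_pmf (\<mu> (colour j v)))"

text \<open>
  The law \<open>\<L>\<^sub>\<mu>\<close> of the tree with root colour distributed according to \<open>p\<close>, as a law on pairs
  of a root colour and a field. The quantities below are conditioned on the root colour and are
  stated with \<^const>\<open>gw_from\<close>; lemma \<open>gw_law_cond\<close> shows that this is the elementary
  conditional law whenever \<open>p\<^sub>j > 0\<close>, whatever \<open>p\<close> is.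
\<close>

definition gw_law :: "'c pmf \<Rightarrow> 'c offspring \<Rightarrow> ('c \<times> 'c gw_field) measure" where
  "gw_law p \<mu> = measure_pmf p \<bind>
     (\<lambda>j. distr (gw_from \<mu> j)
                (count_space UNIV \<Otimes>\<^sub>M (\<Pi>\<^sub>M v\<in>UNIV. count_space UNIV)) (Pair j))"

lemma sets_gw_from: "sets (gw_from \<mu> j) = sets (\<Pi>\<^sub>M v\<in>UNIV. count_space UNIV)"
  unfolding gw_from_def by (rule sets_PiM_cong) auto

lemma space_gw_from: "space (gw_from \<mu> j) = UNIV"
  unfolding gw_from_def by (simp add: space_PiM)

lemma prob_space_gw_from: "prob_space (gw_from \<mu> j)"
  unfolding gw_from_def by (rule prob_space_PiM) (rule measure_pmf.prob_space_axioms)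

lemma gw_law_cond:
  assumes "pmf p j > 0" and A: "A \<in> sets (\<Pi>\<^sub>M v\<in>UNIV. count_space UNIV)"
  shows "\<P>(t in gw_law p \<mu>. snd t \<in> A \<bar> fst t = j) = measure (gw_from \<mu> j) A"
proof -
  let ?F = "(\<Pi>\<^sub>M v\<in>UNIV. count_space UNIV) :: 'c gw_field measure"
  let ?N = "count_space UNIV \<Otimes>\<^sub>M ?F"
  let ?k = "\<lambda>i. distr (gw_from \<mu> i) ?N (Pair i)"
  have meas [measurable]: "Pair i \<in> measurable (gw_from \<mu> i) ?N" for i
  proof -
    have "Pair i \<in> measurable ?F ?N" by measurable
    then show ?thesis
      by (subst measurable_cong_sets[OF sets_gw_from refl])
  qed
  have sp: "prob_space (?k i)" for i
    using prob_space.prob_space_distr[OF prob_space_gw_from meas] .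
  have kernel: "?k \<in> measurable (measure_pmf p) (subprob_algebra ?N)"
    using sp by (simp add: space_subprob_algebra prob_space_imp_subprob_space)
  have sets_law: "sets (gw_law p \<mu>) = sets ?N"
    unfolding gw_law_def by (rule sets_bind) simp_all
  have space_law: "space (gw_law p \<mu>) = UNIV"
    unfolding sets_eq_imp_space_eq[OF sets_law] by (simp add: space_pair_measure space_PiM)
  have slice: "measure (gw_law p \<mu>) ({j} \<times> B) = pmf p j * measure (gw_from \<mu> j) B"
    if B: "B \<in> sets ?F" for B
  proof -
    have jB: "{j} \<times> B \<in> sets ?N" using B by auto
    have "emeasure (gw_law p \<mu>) ({j} \<times> B) = (\<integral>\<^sup>+ i. emeasure (?k i) ({j} \<times> B) \<partial>measure_pmf p)"
      unfolding gw_law_def by (rule emeasure_bind[OF _ kernel jB]) simp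
    also have "\<dots> = (\<integral>\<^sup>+ i. emeasure (gw_from \<mu> j) B * indicator {j} i \<partial>measure_pmf p)"
    proof (rule nn_integral_cong)
      fix i
      have "Pair i -` ({j} \<times> B) = (if i = j then B else {})" by auto
      then show "emeasure (?k i) ({j} \<times> B) = emeasure (gw_from \<mu> j) B * indicator {j} i"
        by (simp add: emeasure_distr[OF meas jB] space_gw_from)
    qed
    also have "\<dots> = emeasure (gw_from \<mu> j) B * emeasure (measure_pmf p) {j}"
      by (subst nn_integral_cmult_indicator) auto
    finally show ?thesis
      by (simp add: measure_def enn2real_mult emeasure_pmf_single)
  qed
  have U: "UNIV \<in> sets ?F"
    using sets.top[of ?F] by (simp add: space_PiM)
  have 1: "{t \<in> space (gw_law p \<mu>). snd t \<in> A \<and> fst t = j} = {j} \<times> A"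
    and 2: "{t \<in> space (gw_law p \<mu>). fst t = j} = {j} \<times> UNIV"
    by (auto simp: space_law)
  have "measure (gw_from \<mu> j) UNIV = 1"
    using prob_space.prob_space[OF prob_space_gw_from[of \<mu> j]] by (simp add: space_gw_from)
  then show ?thesis
    unfolding cond_prob_def 1 2 slice[OF A] slice[OF U] using assms(1) by simp
qed


section \<open>The games\<close>

text \<open>In the escape game Stopper plays the part of \<open>P1\<close> and Escaper the part of \<open>P2\<close>.\<close>

datatype player = P1 | P2

fun opponent :: "player \<Rightarrow> player" where
  "opponent P1 = P2"
| "opponent P2 = P1"

fun permissible :: "('c \<Rightarrow> 'c set) \<Rightarrow> player \<Rightarrow> 'c \<Rightarrow> 'c \<Rightarrow> bool" where
  "permissible S P1 c c' \<longleftrightarrow> c' \<in> S c"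
| "permissible S P2 c c' \<longleftrightarrow> c' \<in> UNIV - S c"

definition moves :: "('c \<Rightarrow> 'c set) \<Rightarrow> 'c \<Rightarrow> 'c gw_field \<Rightarrow> player \<Rightarrow> 'c vertex \<Rightarrow> 'c vertex set" where
  "moves S j \<omega> a u = {v \<in> children \<omega> u. permissible S a (colour j u) (colour j v)}"

text \<open>
  A vertex of the tree determines the whole past of a play that has reached it from the root, so a
  strategy may be taken to be a function of the current vertex.
\<close>

definition strategies ::
    "('c \<Rightarrow> 'c set) \<Rightarrow> 'c \<Rightarrow> 'c gw_field \<Rightarrow> player \<Rightarrow> ('c vertex \<Rightarrow> 'c vertex) set" where
  "strategies S j \<omega> a = {f. \<forall>u. moves S j \<omega> a u \<noteq> {} \<longrightarrow> f u \<in> moves S j \<omega> a u}"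

definition mover :: "player \<Rightarrow> nat \<Rightarrow> player" where
  "mover a n = (if even n then a else opponent a)"

text \<open>
  The position after \<open>n\<close> rounds when \<open>a\<close> plays the first round and each player \<open>b\<close> follows \<open>s b\<close>.
  It is meaningful only as long as nobody has been unable to move.
\<close>

primrec position :: "(player \<Rightarrow> 'c vertex \<Rightarrow> 'c vertex) \<Rightarrow> player \<Rightarrow> nat \<Rightarrow> 'c vertex" where
  "position s a 0 = []"
| "position s a (Suc n) = s (mover a n) (position s a n)"

definition gets_stuck ::
    "('c \<Rightarrow> 'c set) \<Rightarrow> 'c \<Rightarrow> 'c gw_field \<Rightarrow> (player \<Rightarrow> 'c vertex \<Rightarrow> 'c vertex) \<Rightarrow> player \<Rightarrow> player \<Rightarrow> bool"
  where
  "gets_stuck S j \<omega> s a b \<longleftrightarrow>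
     (\<exists>n. (\<forall>l<n. moves S j \<omega> (mover a l) (position s a l) \<noteq> {}) \<and>
          moves S j \<omega> (mover a n) (position s a n) = {} \<and> mover a n = b)"

text \<open>
  When \<open>a\<close> plays the first round, \<open>b\<close> has a strategy guaranteeing that some player in \<open>L\<close> is the first
  one to be unable to move.
\<close>

definition forces_stuck ::
    "('c \<Rightarrow> 'c set) \<Rightarrow> 'c \<Rightarrow> 'c gw_field \<Rightarrow> player \<Rightarrow> player \<Rightarrow> player set \<Rightarrow> bool" where
  "forces_stuck S j \<omega> a b L \<longleftrightarrow>
     (\<exists>f \<in> strategies S j \<omega> b. \<forall>g \<in> strategies S j \<omega> (opponent b).
        \<exists>c\<in>L. gets_stuck S j \<omega> (\<lambda>d. if d = b then f else g) a c)"

definition normal_win :: "('c \<Rightarrow> 'c set) \<Rightarrow> 'c \<Rightarrow> 'c gw_field \<Rightarrow> player \<Rightarrow> player \<Rightarrow> bool" where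
  "normal_win S j \<omega> a b \<longleftrightarrow> forces_stuck S j \<omega> a b {opponent b}"

definition misere_win :: "('c \<Rightarrow> 'c set) \<Rightarrow> 'c \<Rightarrow> 'c gw_field \<Rightarrow> player \<Rightarrow> player \<Rightarrow> bool" where
  "misere_win S j \<omega> a b \<longleftrightarrow> forces_stuck S j \<omega> a b {b}"

definition stopper_win :: "('c \<Rightarrow> 'c set) \<Rightarrow> 'c \<Rightarrow> 'c gw_field \<Rightarrow> player \<Rightarrow> bool" where
  "stopper_win S j \<omega> a \<longleftrightarrow> forces_stuck S j \<omega> a P1 {P1, P2}"


section \<open>Outcome probabilities\<close>

text \<open>A game is lost by \<open>i\<close> if the opponent has a winning strategy, and drawn if nobody has one.\<close>

definition nw :: "('c \<Rightarrow> 'c set) \<Rightarrow> player \<Rightarrow> 'c \<Rightarrow> 'c offspring \<Rightarrow> real" where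
  "nw S i j \<mu> = \<P>(\<omega> in gw_from \<mu> j. normal_win S j \<omega> i i)"

definition nl :: "('c \<Rightarrow> 'c set) \<Rightarrow> player \<Rightarrow> 'c \<Rightarrow> 'c offspring \<Rightarrow> real" where
  "nl S i j \<mu> = \<P>(\<omega> in gw_from \<mu> j. normal_win S j \<omega> i (opponent i))"

definition nd :: "('c \<Rightarrow> 'c set) \<Rightarrow> player \<Rightarrow> 'c \<Rightarrow> 'c offspring \<Rightarrow> real" where
  "nd S i j \<mu> = \<P>(\<omega> in gw_from \<mu> j.
     \<not> normal_win S j \<omega> i i \<and> \<not> normal_win S j \<omega> i (opponent i))"

definition mw :: "('c \<Rightarrow> 'c set) \<Rightarrow> player \<Rightarrow> 'c \<Rightarrow> 'c offspring \<Rightarrow> real" where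
  "mw S i j \<mu> = \<P>(\<omega> in gw_from \<mu> j. misere_win S j \<omega> i i)"

definition ml :: "('c \<Rightarrow> 'c set) \<Rightarrow> player \<Rightarrow> 'c \<Rightarrow> 'c offspring \<Rightarrow> real" where
  "ml S i j \<mu> = \<P>(\<omega> in gw_from \<mu> j. misere_win S j \<omega> i (opponent i))"

definition md :: "('c \<Rightarrow> 'c set) \<Rightarrow> player \<Rightarrow> 'c \<Rightarrow> 'c offspring \<Rightarrow> real" where
  "md S i j \<mu> = \<P>(\<omega> in gw_from \<mu> j.
     \<not> misere_win S j \<omega> i i \<and> \<not> misere_win S j \<omega> i (opponent i))"

definition esw :: "('c \<Rightarrow> 'c set) \<Rightarrow> 'c \<Rightarrow> 'c offspring \<Rightarrow> real" where
  "esw S j \<mu> = \<P>(\<omega> in gw_from \<mu> j. stopper_win S j \<omega> P1)"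

definition eel :: "('c \<Rightarrow> 'c set) \<Rightarrow> 'c \<Rightarrow> 'c offspring \<Rightarrow> real" where
  "eel S j \<mu> = \<P>(\<omega> in gw_from \<mu> j. stopper_win S j \<omega> P2)"


section \<open>The classes of laws\<close>

text \<open>Probability generating function of the marginal of \<open>\<mu>\<^sub>j\<close> on the colours in \<open>K\<close>.\<close>

definition pgf :: "'c \<Rightarrow> 'c set \<Rightarrow> 'c offspring \<Rightarrow> ('c \<Rightarrow> real) \<Rightarrow> real" where
  "pgf j K \<mu> z = measure_pmf.expectation (\<mu> j) (\<lambda>x. \<Prod>k\<in>K. z k ^ x k)"

definition alpha :: "('c \<Rightarrow> 'c set) \<Rightarrow> 'c \<Rightarrow> 'c offspring \<Rightarrow> real" where
  "alpha S j \<mu> = \<P>(\<omega> in gw_from \<mu> j. \<forall>v \<in> children \<omega> []. colour j v \<notin> S j)"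

definition beta :: "('c \<Rightarrow> 'c set) \<Rightarrow> 'c \<Rightarrow> 'c offspring \<Rightarrow> real" where
  "beta S j \<mu> = \<P>(\<omega> in gw_from \<mu> j. \<forall>v \<in> children \<omega> []. colour j v \<notin> UNIV - S j)"

definition D1 :: "('c::finite \<Rightarrow> 'c set) \<Rightarrow> 'c offspring set" where
  "D1 S = {\<mu>. \<forall>j. alpha S j \<mu> > 0}"

definition D2 :: "('c::finite \<Rightarrow> 'c set) \<Rightarrow> 'c offspring set" where
  "D2 S = {\<mu>. \<forall>j. beta S j \<mu> > 0}"

definition D3 :: "('c::finite \<Rightarrow> 'c set) \<Rightarrow> 'c offspring set" where
  "D3 S = {\<mu>. \<forall>j. (\<integral>\<^sup>+ x. of_nat (\<Sum>k\<in>S j. x k) \<partial>measure_pmf (\<mu> j)) < \<infinity>}"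

definition D4 :: "('c::finite \<Rightarrow> 'c set) \<Rightarrow> 'c offspring set" where
  "D4 S = {\<mu>. \<forall>j. (\<integral>\<^sup>+ x. of_nat (\<Sum>k\<in>UNIV - S j. x k) \<partial>measure_pmf (\<mu> j)) < \<infinity>}"

definition C1 :: "('c::finite \<Rightarrow> 'c set) \<Rightarrow> 'c offspring set" where
  "C1 S = {\<mu>. \<forall>j. pgf j (S j) \<mu> (\<lambda>k. beta S k \<mu>) > alpha S j \<mu>}"

definition C2 :: "('c::finite \<Rightarrow> 'c set) \<Rightarrow> 'c offspring set" where
  "C2 S = {\<mu>. \<forall>j. pgf j (UNIV - S j) \<mu> (\<lambda>k. alpha S k \<mu>) > beta S j \<mu>}"

end

theory Submission
  imports Defs
begin

text \<open>
  All six outcomes have the same form: some player can force a player from a given set \<open>L\<close> to be the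
  first one unable to move. The tree is locally finite, so by Koenig's lemma whoever can force this
  can force it within a bounded number of rounds, and the offspring of finitely many vertices
  certify it (\<open>forces_stuck_imp_wins_within\<close>, \<open>finitely_witnessed_forces_stuck\<close>). Hence the set of
  fields won by a player is open in the product of the discrete topologies.

  Lower semicontinuity is then the open-set half of the portmanteau theorem
  (\<open>lsc_at_measure_finitely_witnessed\<close>). The probability that finitely many vertices have prescribed
  offspring is a finite product of point masses, and a point mass changes by at most \<open>d\<^sub>0\<close>; so
  finite disjoint unions of such events have continuous probabilities. An open set is an increasing
  limit of such unions, and a supremum of continuous functions is lower semicontinuous.

  In the normal and in the misere game the two players cannot both win, so the two winning
  probabilities \<open>f\<close> and \<open>g\<close> satisfy \<open>f + g \<le> 1\<close> for every law, with equality where draws have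
  probability 0. At such a law the upper bound \<open>f \<le> 1 - g\<close> is attained and its right-hand side is
  upper semicontinuous; together with the lower semicontinuity of \<open>f\<close> this gives continuity.
\<close>

section \<open>Winning within finitely many rounds\<close>

lemma mover_Suc: "mover a (Suc n) = opponent (mover a n)"
  by (cases a) (auto simp: mover_def)

lemma opponent_opponent [simp]: "opponent (opponent a) = a"
  by (cases a) auto

lemma eq_opponent_iff: "a = opponent b \<longleftrightarrow> a \<noteq> b"
  by (cases a; cases b) auto

lemma finite_moves: "finite (moves S j \<omega> a u)"
  for \<omega> :: "'c::finite gw_field"
proof -
  have "children \<omega> u \<subseteq> (\<Union>k. (\<lambda>n. u @ [(k, n)]) ` {..<\<omega> u k})"
    by (auto simp: children_def)
  then have "finite (children \<omega> u)"
    by (rule finite_subset) auto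
  then show ?thesis
    by (simp add: moves_def)
qed

text \<open>
  The number \<open>n\<close> bounds the rounds up to and including the one in which a player is unable to move.
  It supplies the rank without which a move from winning vertex to winning vertex might never end
  the game.
\<close>

primrec wins_within ::
    "('c \<Rightarrow> 'c set) \<Rightarrow> 'c \<Rightarrow> 'c gw_field \<Rightarrow> player \<Rightarrow> player set \<Rightarrow> nat \<Rightarrow> player \<Rightarrow> 'c vertex \<Rightarrow> bool"
  where
  "wins_within S j \<omega> b L 0 a u \<longleftrightarrow> False"
| "wins_within S j \<omega> b L (Suc n) a u \<longleftrightarrow>
     (if moves S j \<omega> a u = {} then a \<in> L
      else if a = b then \<exists>v \<in> moves S j \<omega> a u. wins_within S j \<omega> b L n (opponent a) v
      else \<forall>v \<in> moves S j \<omega> a u. wins_within S j \<omega> b L n (opponent a) v)"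

lemmas wins_within_Suc = wins_within.simps(2)

text \<open>
  The inductions below need facts with bound \<open>Suc n\<close> intact while the recursion is unfolded one level
  above.
\<close>

declare wins_within_Suc [simp del]

lemma wins_within_Suc_mono:
  "wins_within S j \<omega> b L n a u \<Longrightarrow> wins_within S j \<omega> b L (Suc n) a u"
proof (induction n arbitrary: a u)
  case (Suc n)
  have step: "wins_within S j \<omega> b L (Suc n) (opponent a) v"
    if "wins_within S j \<omega> b L n (opponent a) v" for v
    using that by (rule Suc.IH)
  show ?case
    using Suc.prems step
    by (auto simp: wins_within_Suc[of _ _ _ _ _ "Suc n"] wins_within_Suc[of _ _ _ _ _ n a u]
        split: if_splits)
qed simp

lemma wins_within_mono:
  assumes "wins_within S j \<omega> b L n a u" "n \<le> n'"
  shows "wins_within S j \<omega> b L n' a u"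
  using assms(2,1) by (induction rule: dec_induct) (auto dest: wins_within_Suc_mono)

text \<open>
  This is Koenig's lemma for the game tree: since the opponent has finitely many moves, the bounds
  for the finitely many subsequent vertices have a maximum.
\<close>

lemma wins_within_all_moves:
  fixes \<omega> :: "'c::finite gw_field"
  assumes "\<forall>v \<in> moves S j \<omega> a u. \<exists>n. wins_within S j \<omega> b L n (opponent a) v"
  shows "\<exists>n. \<forall>v \<in> moves S j \<omega> a u. wins_within S j \<omega> b L n (opponent a) v"
proof -
  from assms obtain N where
    N: "\<And>v. v \<in> moves S j \<omega> a u \<Longrightarrow> wins_within S j \<omega> b L (N v) (opponent a) v"
    by metis
  have "wins_within S j \<omega> b L (Max (N ` moves S j \<omega> a u)) (opponent a) v"
    if "v \<in> moves S j \<omega> a u" for v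
    using N[OF that] by (rule wins_within_mono) (simp add: that finite_moves)
  then show ?thesis by blast
qed

text \<open>
  From a vertex not won within any number of rounds, player \<open>b\<close> can only move to another such vertex,
  and by the preceding lemma the opponent, if able to move at all, can choose to do so. An opponent who always does never
  meets a player of \<open>L\<close> unable to move, so no strategy of \<open>b\<close> is winning.
\<close>

lemma forces_stuck_imp_wins_within:
  fixes \<omega> :: "'c::finite gw_field"
  assumes "forces_stuck S j \<omega> a b L"
  shows "\<exists>n. wins_within S j \<omega> b L n a []"
proof (rule ccontr)
  assume not_won: "\<nexists>n. wins_within S j \<omega> b L n a []"
  define safe where "safe c u \<longleftrightarrow> (\<forall>n. \<not> wins_within S j \<omega> b L n c u)" for c u
  have safe_stuck: "c \<notin> L" if "safe c u" "moves S j \<omega> c u = {}" for c u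
    using that unfolding safe_def by (metis wins_within_Suc)
  have safe_own: "safe (opponent b) v" if "safe b u" "v \<in> moves S j \<omega> b u" for u v
    using that unfolding safe_def by (metis wins_within_Suc empty_iff)
  have safe_opp: "\<exists>v \<in> moves S j \<omega> c u. safe b v"
    if "c = opponent b" "safe c u" "moves S j \<omega> c u \<noteq> {}" for c u
  proof (rule ccontr)
    assume "\<not> ?thesis"
    then have "\<forall>v \<in> moves S j \<omega> c u. \<exists>n. wins_within S j \<omega> b L n (opponent c) v"
      using that(1) by (auto simp: safe_def)
    then obtain n where "\<forall>v \<in> moves S j \<omega> c u. wins_within S j \<omega> b L n (opponent c) v"
      using wins_within_all_moves by blast
    then have "wins_within S j \<omega> b L (Suc n) c u"
      using that(1,3) eq_opponent_iff[of c b] by (simp add: wins_within_Suc)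
    then show False using that(2) unfolding safe_def by blast
  qed
  from assms obtain f where f: "f \<in> strategies S j \<omega> b" and
    f_wins: "\<And>g. g \<in> strategies S j \<omega> (opponent b) \<Longrightarrow>
      \<exists>c\<in>L. gets_stuck S j \<omega> (\<lambda>d. if d = b then f else g) a c"
    unfolding forces_stuck_def by blast
  define g where "g u = (SOME v. v \<in> moves S j \<omega> (opponent b) u \<and>
      (safe (opponent b) u \<longrightarrow> safe b v))" for u
  have g: "g u \<in> moves S j \<omega> (opponent b) u \<and> (safe (opponent b) u \<longrightarrow> safe b (g u))"
    if "moves S j \<omega> (opponent b) u \<noteq> {}" for u
    unfolding g_def by (rule someI_ex) (use that safe_opp in blast)
  then have "g \<in> strategies S j \<omega> (opponent b)"
    by (auto simp: strategies_def)
  from f_wins[OF this] obtain c n where c: "c \<in> L"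
    and play: "\<forall>l<n. moves S j \<omega> (mover a l) (position (\<lambda>d. if d = b then f else g) a l) \<noteq> {}"
    and stuck: "moves S j \<omega> (mover a n) (position (\<lambda>d. if d = b then f else g) a n) = {}"
      "mover a n = c"
    by (auto simp: gets_stuck_def)
  have "safe (mover a l) (position (\<lambda>d. if d = b then f else g) a l)" if "l \<le> n" for l
    using that
  proof (induction l)
    case 0
    then show ?case using not_won by (simp add: safe_def mover_def)
  next
    case (Suc l)
    let ?p = "position (\<lambda>d. if d = b then f else g) a l"
    have ne: "moves S j \<omega> (mover a l) ?p \<noteq> {}" and s: "safe (mover a l) ?p"
      using Suc play by auto
    show ?case
    proof (cases "mover a l = b")
      case True
      have "f ?p \<in> moves S j \<omega> b ?p" using f ne True by (auto simp: strategies_def)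
      then show ?thesis using safe_own s True by (simp add: mover_Suc)
    next
      case False
      then have "mover a l = opponent b" by (simp add: eq_opponent_iff)
      then show ?thesis using g[of ?p] ne s False by (simp add: mover_Suc)
    qed
  qed
  from safe_stuck[OF this[OF order_refl] stuck(1)] show False using stuck(2) c by simp
qed

text \<open>
  The strategy: always move to a vertex whose bound is least possible. Then the bound decreases in
  every round, whatever the opponent does, and the game ends before it reaches 0.
\<close>

lemma wins_within_imp_forces_stuck:
  assumes "wins_within S j \<omega> b L n a []"
  shows "forces_stuck S j \<omega> a b L"
proof -
  define good where "good u v n \<longleftrightarrow>
    v \<in> moves S j \<omega> b u \<and> wins_within S j \<omega> b L n (opponent b) v" for u v n
  define f where "f u = (if \<exists>n v. good u v n then SOME v. good u v (LEAST n. \<exists>v. good u v n)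
    else SOME v. v \<in> moves S j \<omega> b u)" for u
  have f_good: "good u (f u) n" if "good u v n" for u v n
  proof -
    have ex: "\<exists>n. \<exists>v. good u v n" using that by blast
    have "good u (f u) (LEAST n. \<exists>v. good u v n)"
      using someI_ex[OF LeastI_ex[OF ex]] ex by (simp add: f_def)
    moreover have "(LEAST n. \<exists>v. good u v n) \<le> n"
      by (rule Least_le) (use that in blast)
    ultimately show ?thesis by (auto simp: good_def intro: wins_within_mono)
  qed
  have f: "f \<in> strategies S j \<omega> b"
    unfolding strategies_def
  proof (intro CollectI allI impI)
    fix u assume ne: "moves S j \<omega> b u \<noteq> {}"
    show "f u \<in> moves S j \<omega> b u"
    proof (cases "\<exists>n v. good u v n")
      case True
      then show ?thesis using f_good by (auto simp: good_def)
    next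
      case False
      then have "f u = (SOME v. v \<in> moves S j \<omega> b u)" unfolding f_def by (rule if_not_P)
      then show ?thesis using ne by (simp add: some_in_eq)
    qed
  qed
  have "\<exists>c\<in>L. gets_stuck S j \<omega> (\<lambda>d. if d = b then f else g) a c"
    if g: "g \<in> strategies S j \<omega> (opponent b)" for g
  proof -
    let ?p = "position (\<lambda>d. if d = b then f else g) a"
    have "\<exists>c\<in>L. gets_stuck S j \<omega> (\<lambda>d. if d = b then f else g) a c"
      if "wins_within S j \<omega> b L n (mover a t) (?p t)"
        and "\<forall>l<t. moves S j \<omega> (mover a l) (?p l) \<noteq> {}" for n t
      using that
    proof (induction n arbitrary: t)
      case (Suc n)
      show ?case
      proof (cases "moves S j \<omega> (mover a t) (?p t) = {}")
        case True
        then show ?thesis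
          using Suc.prems unfolding gets_stuck_def by (auto simp: wins_within_Suc)
      next
        case ne: False
        have "wins_within S j \<omega> b L n (mover a (Suc t)) (?p (Suc t))"
        proof (cases "mover a t = b")
          case True
          then obtain v where "good (?p t) v n"
            using Suc.prems(1) ne by (auto simp: good_def wins_within_Suc)
          then show ?thesis using f_good True by (auto simp: good_def mover_Suc)
        next
          case False
          then have opp: "mover a t = opponent b" by (simp add: eq_opponent_iff)
          have "g (?p t) \<in> moves S j \<omega> (mover a t) (?p t)"
            using g ne opp by (auto simp: strategies_def)
          then show ?thesis using Suc.prems(1) ne False by (auto simp: mover_Suc wins_within_Suc)
        qed
        then show ?thesis
          by (rule Suc.IH) (use Suc.prems(2) ne in \<open>auto simp: less_Suc_eq\<close>)
      qed
    qed simp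
    from this[of _ 0] show ?thesis using assms by (simp add: mover_def)
  qed
  with f show ?thesis unfolding forces_stuck_def by blast
qed

text \<open>Playing the two strategies against each other, only one player is the first to get stuck.\<close>

lemma forces_stuck_exclusive:
  assumes "forces_stuck S j \<omega> a b L" "forces_stuck S j \<omega> a (opponent b) L'"
  shows "L \<inter> L' \<noteq> {}"
proof -
  from assms(1) obtain f where f: "f \<in> strategies S j \<omega> b"
    "\<forall>g \<in> strategies S j \<omega> (opponent b).
       \<exists>c\<in>L. gets_stuck S j \<omega> (\<lambda>d. if d = b then f else g) a c"
    unfolding forces_stuck_def by blast
  from assms(2) obtain g where g: "g \<in> strategies S j \<omega> (opponent b)"
    "\<forall>f \<in> strategies S j \<omega> b.
       \<exists>c\<in>L'. gets_stuck S j \<omega> (\<lambda>d. if d = opponent b then g else f) a c"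
    unfolding forces_stuck_def by auto
  have same: "(\<lambda>d. if d = opponent b then g else f) = (\<lambda>d. if d = b then f else g)"
    by (auto simp: eq_opponent_iff)
  obtain c where c: "c \<in> L" "gets_stuck S j \<omega> (\<lambda>d. if d = b then f else g) a c"
    using f(2) g(1) by blast
  obtain c' where c': "c' \<in> L'" "gets_stuck S j \<omega> (\<lambda>d. if d = b then f else g) a c'"
    using bspec[OF g(2) f(1)] unfolding same by blast
  have "c = c'"
    using c(2) c'(2) unfolding gets_stuck_def by (metis (lifting) linorder_neqE_nat)
  with c c' show ?thesis by blast
qed

section \<open>Events certified by finitely many vertices\<close>

definition cylinder :: "'c vertex set \<Rightarrow> 'c gw_field \<Rightarrow> 'c gw_field set" where
  "cylinder J x = {\<omega>. \<forall>u\<in>J. \<omega> u = x u}"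

text \<open>Openness in the product of the discrete topologies on the offspring vectors of the vertices.\<close>

definition finitely_witnessed :: "'c gw_field set \<Rightarrow> bool" where
  "finitely_witnessed E \<longleftrightarrow> (\<forall>\<omega>\<in>E. \<exists>J. finite J \<and> cylinder J \<omega> \<subseteq> E)"

text \<open>
  A certificate for the game at \<open>u\<close> consists of \<open>u\<close>, which fixes the available moves, and of
  certificates for the finitely many winning vertices among them.
\<close>

lemma finitely_witnessed_wins_within:
  "finitely_witnessed {\<omega> :: 'c::finite gw_field. wins_within S j \<omega> b L n a u}"
proof (induction n arbitrary: a u)
  case 0
  then show ?case by (simp add: finitely_witnessed_def)
next
  case (Suc n)
  show ?case
    unfolding finitely_witnessed_def
  proof clarify
    fix \<omega> :: "'c gw_field"
    assume win: "wins_within S j \<omega> b L (Suc n) a u"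
    let ?W = "\<lambda>v \<omega>'. wins_within S j \<omega>' b L n (opponent a) v"
    have "\<forall>v. \<exists>J. ?W v \<omega> \<longrightarrow> finite J \<and> cylinder J \<omega> \<subseteq> {\<omega>'. ?W v \<omega>'}"
      using Suc.IH[of "opponent a"] unfolding finitely_witnessed_def by blast
    from choice[OF this] obtain J where
      J: "\<And>v. ?W v \<omega> \<Longrightarrow> finite (J v)"
        "\<And>v \<omega>'. ?W v \<omega> \<Longrightarrow> \<omega>' \<in> cylinder (J v) \<omega> \<Longrightarrow> ?W v \<omega>'"
      by blast
    define J' where "J' = insert u (\<Union>v \<in> {v \<in> moves S j \<omega> a u. ?W v \<omega>}. J v)"
    have "finite J'"
      unfolding J'_def using J(1)
      by (intro finite.insertI finite_UN_I) (auto intro: finite_subset[OF _ finite_moves[of S j \<omega> a u]])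
    moreover have "wins_within S j \<omega>' b L (Suc n) a u" if "\<omega>' \<in> cylinder J' \<omega>" for \<omega>'
    proof -
      have "\<omega>' u = \<omega> u" using that by (auto simp: J'_def cylinder_def)
      then have moves_eq: "moves S j \<omega>' a u = moves S j \<omega> a u"
        by (simp add: moves_def children_def)
      have "?W v \<omega>'" if "v \<in> moves S j \<omega> a u" "?W v \<omega>" for v
        using J(2)[OF that(2)] \<open>\<omega>' \<in> cylinder J' \<omega>\<close> that by (auto simp: J'_def cylinder_def)
      then show ?thesis using win unfolding wins_within_Suc moves_eq by (auto split: if_splits)
    qed
    ultimately show "\<exists>J. finite J \<and> cylinder J \<omega> \<subseteq> {\<omega>'. wins_within S j \<omega>' b L (Suc n) a u}"
      by blast
  qed
qed

lemma finitely_witnessed_forces_stuck: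
  "finitely_witnessed {\<omega> :: 'c::finite gw_field. forces_stuck S j \<omega> a b L}"
  unfolding finitely_witnessed_def
proof clarify
  fix \<omega> :: "'c gw_field"
  assume "forces_stuck S j \<omega> a b L"
  then obtain n where "wins_within S j \<omega> b L n a []"
    using forces_stuck_imp_wins_within by blast
  then have "\<omega> \<in> {\<omega>. wins_within S j \<omega> b L n a []}"
    by simp
  from finitely_witnessed_wins_within[unfolded finitely_witnessed_def, THEN bspec, OF this]
  obtain J where "finite J" "cylinder J \<omega> \<subseteq> {\<omega>. wins_within S j \<omega> b L n a []}"
    by blast
  moreover have "{\<omega>. wins_within S j \<omega> b L n a []} \<subseteq> {\<omega>. forces_stuck S j \<omega> a b L}"
    by (rule Collect_mono) (simp add: wins_within_imp_forces_stuck)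
  ultimately show "\<exists>J. finite J \<and> cylinder J \<omega> \<subseteq> {\<omega>. forces_stuck S j \<omega> a b L}"
    by (meson subset_trans)
qed

section \<open>Lower semicontinuity of the probabilities of such events\<close>

lemma cylinder_eq_prod_emb:
  "cylinder J x = prod_emb UNIV (\<lambda>v. measure_pmf (\<mu> (colour j v))) J (\<Pi>\<^sub>E u\<in>J. {x u})"
  by (auto simp: cylinder_def prod_emb_def PiE_iff)

lemma sets_cylinder [measurable]: "finite J \<Longrightarrow> cylinder J x \<in> sets (gw_from \<mu> j)"
  unfolding cylinder_eq_prod_emb[of _ _ \<mu> j] gw_from_def by (rule sets_PiM_I) auto

lemma measure_cylinder:
  assumes "finite J"
  shows "measure (gw_from \<mu> j) (cylinder J x) = (\<Prod>u\<in>J. pmf (\<mu> (colour j u)) (x u))"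
proof -
  interpret product_prob_space "\<lambda>v. measure_pmf (\<mu> (colour j v))" UNIV
    by standard
  have "emeasure (gw_from \<mu> j) (cylinder J x) = (\<Prod>u\<in>J. ennreal (pmf (\<mu> (colour j u)) (x u)))"
    unfolding cylinder_eq_prod_emb[of _ _ \<mu> j] gw_from_def
    by (subst emeasure_PiM_emb) (use assms in \<open>auto simp: emeasure_pmf_single\<close>)
  also have "\<dots> = ennreal (\<Prod>u\<in>J. pmf (\<mu> (colour j u)) (x u))"
    by (rule prod_ennreal) simp
  finally show ?thesis
    by (simp add: measure_def prod_nonneg)
qed

lemma tendsto_pmf_law_topology:
  "((\<lambda>\<nu>. pmf (\<nu> c) x) \<longlongrightarrow> pmf (\<mu> c) x) (atin law_topology \<mu>)"
proof (rule tendstoI)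
  fix e :: real assume e: "e > 0"
  have "\<bar>pmf (\<nu> c) x - pmf (\<mu> c) x\<bar> \<le> d0 \<mu> \<nu>" for \<nu>
    using tv_dist_upper[of "\<mu> c" "{x}" "\<nu> c"] tv_dist_le_d0[of \<mu> c \<nu>]
    by (simp add: measure_pmf_single abs_minus_commute)
  then have "dist (pmf (\<nu> c) x) (pmf (\<mu> c) x) < e" if "\<nu> \<in> d0.mball \<mu> e" for \<nu>
    using that by (force simp: dist_real_def intro: le_less_trans)
  then show "\<forall>\<^sub>F \<nu> in atin law_topology \<mu>. dist (pmf (\<nu> c) x) (pmf (\<mu> c) x) < e"
    unfolding eventually_atin using e by (intro disjI2 exI[of _ "d0.mball \<mu> e"]) auto
qed

lemma tendsto_atin_imp_lsc_at:
  assumes "x \<in> topspace X" "(f \<longlongrightarrow> f x) (atin X x)"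
  shows "lsc_at X f x"
  unfolding lsc_at_def
proof (intro conjI allI impI)
  fix y assume "y < f x"
  with order_tendstoD(1)[OF assms(2)]
  obtain U where "openin X U" "x \<in> U" "\<forall>z\<in>U - {x}. y < f z"
    using assms(1) unfolding eventually_atin by blast
  with \<open>y < f x\<close> show "\<exists>U. openin X U \<and> x \<in> U \<and> (\<forall>z\<in>U. y < f z)"
    by blast
qed (rule assms(1))

lemma lsc_at_limit_of_minorants:
  assumes "x \<in> topspace X" "\<And>n. lsc_at X (f n) x" "\<And>n z. f n z \<le> g z"
    "(\<lambda>n. f n x) \<longlonglongrightarrow> g x"
  shows "lsc_at X g x"
  unfolding lsc_at_def
proof (intro conjI allI impI)
  fix y assume "y < g x"
  then obtain n where "y < f n x"
    using order_tendstoD(1)[OF assms(4)] by (auto simp: eventually_sequentially)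
  with assms(2)[of n] obtain U where "openin X U" "x \<in> U" "\<forall>z\<in>U. y < f n z"
    unfolding lsc_at_def by blast
  then show "\<exists>U. openin X U \<and> x \<in> U \<and> (\<forall>z\<in>U. y < g z)"
    using assms(3) by (meson less_le_trans)
qed (rule assms(1))

lemma lsc_at_measure_incseq_Union:
  fixes E :: "nat \<Rightarrow> 'c::finite gw_field set"
  assumes "incseq E" "\<And>n. E n \<in> sets (\<Pi>\<^sub>M v\<in>UNIV. count_space UNIV)"
    "\<And>n. lsc_at law_topology (\<lambda>\<nu>. measure (gw_from \<nu> j) (E n)) \<mu>"
  shows "lsc_at law_topology (\<lambda>\<nu>. measure (gw_from \<nu> j) (\<Union>n. E n)) \<mu>"
proof (rule lsc_at_limit_of_minorants[OF _ assms(3)])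
  have sets: "E n \<in> sets (gw_from \<nu> j)" for n \<nu>
    using assms(2) by (simp add: sets_gw_from)
  have fin: "finite_measure (gw_from \<nu> j)" for \<nu>
    using prob_space_gw_from by (rule prob_space.finite_measure)
  show "measure (gw_from \<nu> j) (E n) \<le> measure (gw_from \<nu> j) (\<Union>n. E n)" for n \<nu>
    by (rule finite_measure.finite_measure_mono[OF fin]) (use sets in auto)
  show "(\<lambda>n. measure (gw_from \<mu> j) (E n)) \<longlonglongrightarrow> measure (gw_from \<mu> j) (\<Union>n. E n)"
    by (rule finite_measure.finite_Lim_measure_incseq[OF fin]) (use sets assms(1) in auto)
qed simp

text \<open>
  Requiring the offspring vectors on \<open>J\<close> to lie in a finite set makes the event a finite union of
  cylinders, so its probability is a finite sum of finite products of point masses.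
\<close>

lemma
  fixes E :: "'c::finite gw_field set"
  assumes J: "finite J" and C: "finite C"
  defines "K \<equiv> {\<omega>. (\<forall>u\<in>J. \<omega> u \<in> C) \<and> cylinder J \<omega> \<subseteq> E}"
  shows sets_bounded_cylinders: "K \<in> sets (\<Pi>\<^sub>M v\<in>UNIV. count_space UNIV)" (is ?sets)
    and lsc_at_measure_bounded_cylinders:
      "lsc_at law_topology (\<lambda>\<nu>. measure (gw_from \<nu> j) K) \<mu>" (is ?lsc)
proof -
  (* Functions that are undefined off J index each cylinder only once, which makes the union disjoint. *)
  define A where "A = {x \<in> J \<rightarrow>\<^sub>E C. cylinder J x \<subseteq> E}"
  have A: "finite A"
    using finite_PiE[OF J, of "\<lambda>_. C"] C by (simp add: A_def)
  have K: "K = (\<Union>x\<in>A. cylinder J x)"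
  proof (intro equalityI subsetI)
    fix \<omega> assume \<omega>: "\<omega> \<in> K"
    have "cylinder J (restrict \<omega> J) = cylinder J \<omega>"
      by (auto simp: cylinder_def)
    with \<omega> have "restrict \<omega> J \<in> A" by (auto simp: A_def K_def)
    moreover have "\<omega> \<in> cylinder J (restrict \<omega> J)" by (simp add: cylinder_def)
    ultimately show "\<omega> \<in> (\<Union>x\<in>A. cylinder J x)" by blast
  next
    fix \<omega> assume "\<omega> \<in> (\<Union>x\<in>A. cylinder J x)"
    then obtain x where x: "x \<in> A" "\<omega> \<in> cylinder J x" by blast
    then have "cylinder J \<omega> = cylinder J x" by (auto simp: cylinder_def)
    with x show "\<omega> \<in> K" by (auto simp: A_def K_def cylinder_def PiE_iff)
  qed
  have disj: "disjoint_family_on (cylinder J) A"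
    unfolding disjoint_family_on_def
  proof (intro ballI impI)
    fix x y assume "x \<in> A" "y \<in> A" "x \<noteq> y"
    then have "\<exists>u\<in>J. x u \<noteq> y u" unfolding A_def by (metis (lifting) PiE_ext mem_Collect_eq)
    then show "cylinder J x \<inter> cylinder J y = {}" by (auto simp: cylinder_def)
  qed
  have sets: "K \<in> sets (gw_from \<nu> j)" for \<nu>
    unfolding K using A J by (intro sets.finite_UN sets_cylinder)
  then show ?sets by (simp add: sets_gw_from)
  have "measure (gw_from \<nu> j) K = (\<Sum>x\<in>A. \<Prod>u\<in>J. pmf (\<nu> (colour j u)) (x u))" for \<nu>
    unfolding K
    by (subst finite_measure.finite_measure_finite_Union)
       (use A J disj prob_space.finite_measure[OF prob_space_gw_from] sets_cylinder in
         \<open>auto simp: measure_cylinder\<close>)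
  then show ?lsc
    by (intro tendsto_atin_imp_lsc_at) (auto intro!: tendsto_sum tendsto_prod tendsto_pmf_law_topology)
qed

text \<open>
  The open set is exhausted in two stages: by the events already certified by the vertices with
  code below \<open>N\<close>, and each of these by bounding the codes of the offspring vectors of these
  vertices. A single parameter for both bounds would not give an increasing sequence, because a larger
  \<open>N\<close> bounds the offspring of more vertices.
\<close>

lemma
  fixes E :: "'c::finite gw_field set"
  assumes E: "finitely_witnessed E"
  shows sets_finitely_witnessed: "E \<in> sets (\<Pi>\<^sub>M v\<in>UNIV. count_space UNIV)" (is ?sets)
    and lsc_at_measure_finitely_witnessed:
      "lsc_at law_topology (\<lambda>\<nu>. measure (gw_from \<nu> j) E) \<mu>" (is ?lsc)
proof -
  define J :: "nat \<Rightarrow> 'c vertex set" where "J N = {u. to_nat u < N}" for N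
  define C :: "nat \<Rightarrow> ('c \<Rightarrow> nat) set" where "C M = {x. to_nat x < M}" for M
  define K where "K N M = {\<omega>. (\<forall>u\<in>J N. \<omega> u \<in> C M) \<and> cylinder (J N) \<omega> \<subseteq> E}" for N M
  define E' where "E' N = {\<omega>. cylinder (J N) \<omega> \<subseteq> E}" for N
  have J: "finite (J N)" for N
    using finite_vimageI[of "{..<N}" "to_nat :: 'c vertex \<Rightarrow> nat"]
    by (simp add: J_def vimage_def lessThan_def)
  have C: "finite (C M)" for M
    using finite_vimageI[of "{..<M}" "to_nat :: ('c \<Rightarrow> nat) \<Rightarrow> nat"]
    by (simp add: C_def vimage_def lessThan_def)
  have E'_Union: "E' N = (\<Union>M. K N M)" for N
  proof -
    have "\<exists>M. \<forall>u\<in>J N. \<omega> u \<in> C M" for \<omega>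
      by (rule exI[of _ "Suc (Max ((\<lambda>u. to_nat (\<omega> u)) ` J N))"])
         (auto simp: C_def less_Suc_eq_le J)
    then show ?thesis by (auto simp: E'_def K_def)
  qed
  have K_inc: "incseq (K N)" for N
    by (auto simp: incseq_def K_def C_def)
  have K_sets: "K N M \<in> sets (\<Pi>\<^sub>M v\<in>UNIV. count_space UNIV)" for N M
    unfolding K_def by (rule sets_bounded_cylinders[OF J C])
  have E'_inc: "incseq E'"
    by (auto simp: incseq_def E'_def J_def cylinder_def subset_iff)
  have E'_sets: "E' N \<in> sets (\<Pi>\<^sub>M v\<in>UNIV. count_space UNIV)" for N
    unfolding E'_Union using K_sets by auto
  have E'_lsc: "lsc_at law_topology (\<lambda>\<nu>. measure (gw_from \<nu> j) (E' N)) \<mu>" for N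
    unfolding E'_Union
    by (rule lsc_at_measure_incseq_Union[OF K_inc K_sets])
       (unfold K_def, rule lsc_at_measure_bounded_cylinders[OF J C])
  have E_Union: "E = (\<Union>N. E' N)"
  proof (intro equalityI subsetI)
    fix \<omega> assume "\<omega> \<in> E"
    then obtain I where I: "finite I" "cylinder I \<omega> \<subseteq> E"
      using E unfolding finitely_witnessed_def by blast
    have "I \<subseteq> J (Suc (Max (to_nat ` I)))"
      using I(1) by (auto simp: J_def less_Suc_eq_le)
    then have "cylinder (J (Suc (Max (to_nat ` I)))) \<omega> \<subseteq> E"
      using I(2) by (auto simp: cylinder_def subset_iff)
    then show "\<omega> \<in> (\<Union>N. E' N)" by (auto simp: E'_def)
  qed (auto simp: E'_def cylinder_def)
  show ?sets unfolding E_Union using E'_sets by auto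
  show ?lsc unfolding E_Union by (rule lsc_at_measure_incseq_Union[OF E'_inc E'_sets E'_lsc])
qed

section \<open>Continuity where the remaining probability vanishes\<close>

text \<open>The upper semicontinuous bound \<open>1 - g\<close> on \<open>f\<close> is attained at \<open>x\<close>.\<close>

lemma topcontinuous_at_if_complementary_lsc:
  assumes f: "lsc_at X f x" and g: "lsc_at X g x"
    and le: "\<And>z. f z + g z \<le> 1" and eq: "f x + g x = 1"
  shows "topcontinuous_at X euclideanreal f x"
  unfolding topcontinuous_at_def
proof (intro conjI allI impI)
  show "x \<in> topspace X" using f by (simp add: lsc_at_def)
  fix V assume "openin euclideanreal V \<and> f x \<in> V"
  then obtain e where e: "e > 0" "\<And>t. dist t (f x) < e \<Longrightarrow> t \<in> V"
    by (auto simp: open_dist)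
  have "f x - e < f x" "g x - e < g x" using e(1) by auto
  then obtain U U' where "openin X U" "x \<in> U" "\<forall>z\<in>U. f x - e < f z"
    and "openin X U'" "x \<in> U'" "\<forall>z\<in>U'. g x - e < g z"
    using f g unfolding lsc_at_def by meson
  moreover have "f z \<in> V" if "f x - e < f z" "g x - e < g z" for z
    using e(2)[of "f z"] le[of z] eq that by (simp add: dist_real_def abs_less_iff)
  ultimately show "\<exists>U. openin X U \<and> x \<in> U \<and> (\<forall>z\<in>U. f z \<in> V)"
    by (intro exI[of _ "U \<inter> U'"]) auto
qed simp

lemma lsc_at_prob_forces_stuck:
  fixes S :: "'c::finite \<Rightarrow> 'c set"
  shows "lsc_at law_topology (\<lambda>\<nu>. \<P>(\<omega> in gw_from \<nu> j. forces_stuck S j \<omega> a b L)) \<mu>"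
  using lsc_at_measure_finitely_witnessed[OF finitely_witnessed_forces_stuck]
  by (simp add: space_gw_from)

lemma prob_forces_stuck_sum:
  fixes S :: "'c::finite \<Rightarrow> 'c set"
  assumes "L \<inter> L' = {}"
  shows "\<P>(\<omega> in gw_from \<mu> j. forces_stuck S j \<omega> a b L) +
      \<P>(\<omega> in gw_from \<mu> j. forces_stuck S j \<omega> a (opponent b) L') +
      \<P>(\<omega> in gw_from \<mu> j. \<not> forces_stuck S j \<omega> a b L \<and>
        \<not> forces_stuck S j \<omega> a (opponent b) L') = 1"
proof -
  interpret prob_space "gw_from \<mu> j" by (rule prob_space_gw_from)
  let ?W = "{\<omega>. forces_stuck S j \<omega> a b L}"
  let ?W' = "{\<omega>. forces_stuck S j \<omega> a (opponent b) L'}"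
  have W: "{\<omega>. forces_stuck S j \<omega> a b L} \<in> events" for b L
    using sets_finitely_witnessed[OF finitely_witnessed_forces_stuck] by (simp add: sets_gw_from)
  have "?W \<inter> ?W' = {}"
    using forces_stuck_exclusive[of S j _ a b L L'] assms by auto
  then have "prob (?W \<union> ?W') = prob ?W + prob ?W'"
    by (intro finite_measure_Union W)
  moreover have "prob (space (gw_from \<mu> j) - (?W \<union> ?W')) = 1 - prob (?W \<union> ?W')"
    by (intro prob_compl sets.Un W)
  moreover have "space (gw_from \<mu> j) - (?W \<union> ?W') =
      {\<omega>. \<not> forces_stuck S j \<omega> a b L \<and> \<not> forces_stuck S j \<omega> a (opponent b) L'}"
    by (auto simp: space_gw_from)
  ultimately show ?thesis by (simp add: space_gw_from)
qed

lemma topcontinuous_at_prob_forces_stuck: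
  fixes S :: "'c::finite \<Rightarrow> 'c set"
  assumes disj: "L \<inter> L' = {}"
    and draw: "\<P>(\<omega> in gw_from \<mu> j. \<not> forces_stuck S j \<omega> a b L \<and>
        \<not> forces_stuck S j \<omega> a (opponent b) L') = 0"
  shows "topcontinuous_at law_topology euclideanreal
           (\<lambda>\<nu>. \<P>(\<omega> in gw_from \<nu> j. forces_stuck S j \<omega> a b L)) \<mu>"
    and "topcontinuous_at law_topology euclideanreal
           (\<lambda>\<nu>. \<P>(\<omega> in gw_from \<nu> j. forces_stuck S j \<omega> a (opponent b) L')) \<mu>"
proof -
  let ?f = "\<lambda>\<nu>. \<P>(\<omega> in gw_from \<nu> j. forces_stuck S j \<omega> a b L)"
  let ?g = "\<lambda>\<nu>. \<P>(\<omega> in gw_from \<nu> j. forces_stuck S j \<omega> a (opponent b) L')"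
  have le: "?f \<nu> + ?g \<nu> \<le> 1" for \<nu>
    using prob_forces_stuck_sum[OF disj, of \<nu> j S a b]
    by (smt (verit) measure_nonneg)
  have eq: "?f \<mu> + ?g \<mu> = 1"
    using prob_forces_stuck_sum[OF disj, of \<mu> j S a b] draw by linarith
  have f: "lsc_at law_topology ?f \<mu>" and g: "lsc_at law_topology ?g \<mu>"
    by (rule lsc_at_prob_forces_stuck)+
  show "topcontinuous_at law_topology euclideanreal ?f \<mu>"
    by (rule topcontinuous_at_if_complementary_lsc[where f = ?f and g = ?g]) (fact f g le eq)+
  have "?g \<nu> + ?f \<nu> \<le> 1" for \<nu>
    using le[of \<nu>] by linarith
  moreover have "?g \<mu> + ?f \<mu> = 1"
    using eq by linarith
  ultimately show "topcontinuous_at law_topology euclideanreal ?g \<mu>"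
    using f g by (intro topcontinuous_at_if_complementary_lsc[where f = ?g and g = ?f])
qed

theorem theorem1p8:
  fixes S :: "'c::finite \<Rightarrow> 'c set" and \<mu> :: "'c offspring" and i :: player and j :: 'c
  assumes "\<And>c. S c \<noteq> {}" and "\<And>c. S c \<noteq> UNIV"
  shows "(\<mu> \<in> (D1 S \<union> D4 S) \<inter> (D2 S \<union> D3 S) \<longrightarrow>
           lsc_at law_topology (nw S i j) \<mu> \<and> lsc_at law_topology (nl S i j) \<mu> \<and>
           (nd S i j \<mu> = 0 \<longrightarrow>
              topcontinuous_at law_topology euclideanreal (nw S i j) \<mu> \<and>
              topcontinuous_at law_topology euclideanreal (nl S i j) \<mu>)) \<and>
         (\<mu> \<in> (C1 S \<union> D4 S) \<inter> (C2 S \<union> D3 S) \<longrightarrow>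
           lsc_at law_topology (mw S i j) \<mu> \<and> lsc_at law_topology (ml S i j) \<mu> \<and>
           (md S i j \<mu> = 0 \<longrightarrow>
              topcontinuous_at law_topology euclideanreal (mw S i j) \<mu> \<and>
              topcontinuous_at law_topology euclideanreal (ml S i j) \<mu>)) \<and>
         (\<mu> \<in> D3 S \<inter> D4 S \<longrightarrow>
           lsc_at law_topology (esw S j) \<mu> \<and> lsc_at law_topology (eel S j) \<mu>)"
proof -
  have nw: "nw S i j = (\<lambda>\<nu>. \<P>(\<omega> in gw_from \<nu> j. forces_stuck S j \<omega> i i {opponent i}))"
    and nl: "nl S i j = (\<lambda>\<nu>. \<P>(\<omega> in gw_from \<nu> j. forces_stuck S j \<omega> i (opponent i) {i}))"
    and mw: "mw S i j = (\<lambda>\<nu>. \<P>(\<omega> in gw_from \<nu> j. forces_stuck S j \<omega> i i {i}))"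
    and ml: "ml S i j =
      (\<lambda>\<nu>. \<P>(\<omega> in gw_from \<nu> j. forces_stuck S j \<omega> i (opponent i) {opponent i}))"
    and esw: "esw S j = (\<lambda>\<nu>. \<P>(\<omega> in gw_from \<nu> j. forces_stuck S j \<omega> P1 P1 {P1, P2}))"
    and eel: "eel S j = (\<lambda>\<nu>. \<P>(\<omega> in gw_from \<nu> j. forces_stuck S j \<omega> P2 P1 {P1, P2}))"
    by (auto simp: fun_eq_iff nw_def nl_def mw_def ml_def esw_def eel_def
        normal_win_def misere_win_def stopper_win_def)
  have disj: "{opponent i} \<inter> {i} = {}" "{i} \<inter> {opponent i} = {}"
    by (cases i; simp)+
  have normal: "topcontinuous_at law_topology euclideanreal (nw S i j) \<mu> \<and>
      topcontinuous_at law_topology euclideanreal (nl S i j) \<mu>" if "nd S i j \<mu> = 0"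
    using topcontinuous_at_prob_forces_stuck[OF disj(1), of \<mu> j S i i] that
    by (simp add: nw nl nd_def normal_win_def)
  have misere: "topcontinuous_at law_topology euclideanreal (mw S i j) \<mu> \<and>
      topcontinuous_at law_topology euclideanreal (ml S i j) \<mu>" if "md S i j \<mu> = 0"
    using topcontinuous_at_prob_forces_stuck[OF disj(2), of \<mu> j S i i] that
    by (simp add: mw ml md_def misere_win_def)
  have "lsc_at law_topology (nw S i j) \<mu>" "lsc_at law_topology (nl S i j) \<mu>"
    "lsc_at law_topology (mw S i j) \<mu>" "lsc_at law_topology (ml S i j) \<mu>"
    "lsc_at law_topology (esw S j) \<mu>" "lsc_at law_topology (eel S j) \<mu>"
    unfolding nw nl mw ml esw eel by (rule lsc_at_prob_forces_stuck)+
  with normal misere show ?thesis by blast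
qed

end
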